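(* Let $(M,d)$ be a generalized metric space. The map $d_Q:M_C^+\times M_C^+\to[0,\infty]$ given by $$d_Q([\{x_n\}],[\{y_n\}]):=\lim_n(\lim_md(x_n,y_m))$$ is well-defined and is a quasi-distance on the forward Cauchy completion $M_C^+$. Analogously, the reversed generalized distance $d^{\mathrm{rev}}$ extends (by the same formula with $d^{\mathrm{rev}}$) to a quasi-distance $d^{\mathrm{rev}}_Q$ on $M_C^-$, and the symmetrized distance $d^s$ extends to a distance $\overline d^s:M_C^s\times M_C^s\to\mathbb R$ which satisfies $\overline d^s=(d_Q+d_Q^{\mathrm{rev}})/2$ on $M_C^s$.
   Context: A generalized metric space $(M,d)$ is a set with a map $d:M\times M\to\mathbb R$ satisfying: (a1) $d\ge0$; (a2) $d(x,y)=d(y,x)=0$ iff $x=y$; (a3) $d(x,z)\le d(x,y)+d(y,z)$; (a4) for any sequence $\{x_n\}$ and $x\in M$, $d(x_n,x)\to0$ iff $d(x,x_n)\to0$. A quasi-distance on a set is a map with values in $\mathbb R\cup\{\infty\}$ satisfying (a1), (a2), (a3). $d^{\mathrm{rev}}(x,y)=d(y,x)$ and $d^s=\frac12(d+d^{\mathrm{rev}})$. $\{x_n\}$ is a forward Cauchy sequence if for all $\epsilon>0$ there is $n_0$ with $d(x_n,x_m)<\epsilon$ whenever $n_0\le n\le m$; a backward Cauchy sequence is a forward Cauchy sequence for $d^{\mathrm{rev}}$. Two forward Cauchy sequences are equivalent if $\lim_n(\lim_md(x_n,x'_m))=\lim_n(\lim_md(x'_n,x_m))=0$. $M_C^+$ is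 the set of equivalence classes of forward Cauchy sequences; $M$ is regarded as the subset of classes of convergent sequences; $\partial_C^+M=M_C^+\setminus M$. $M_C^-$ and $\partial_C^-M$ are defined in the same way with $d^{\mathrm{rev}}$. $\partial_C^sM=\partial_C^+M\cap\partial_C^-M$ (points represented by the same class of sequences) and $M_C^s=M\cup\partial_C^sM$. *)

theory Defs
  imports "HOL-Analysis.Analysis"
begin

locale generalized_metric_space =
  fixes M :: "'a set" and d :: "'a \<Rightarrow> 'a \<Rightarrow> real"
  assumes nonneg: "\<lbrakk>x \<in> M; y \<in> M\<rbrakk> \<Longrightarrow> 0 \<le> d x y"
    and zero: "\<lbrakk>x \<in> M; y \<in> M\<rbrakk> \<Longrightarrow> d x y = 0 \<and> d y x = 0 \<longleftrightarrow> x = y"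
    and triangle: "\<lbrakk>x \<in> M; y \<in> M; z \<in> M\<rbrakk> \<Longrightarrow> d x z \<le> d x y + d y z"
    and tendsto_iff: "\<lbrakk>range s \<subseteq> M; x \<in> M\<rbrakk> \<Longrightarrow>
      (\<lambda>n. d (s n) x) \<longlonglongrightarrow> 0 \<longleftrightarrow> (\<lambda>n. d x (s n)) \<longlonglongrightarrow> 0"

definition quasi_distance_on :: "'b set \<Rightarrow> ('b \<Rightarrow> 'b \<Rightarrow> ereal) \<Rightarrow> bool" where
  "quasi_distance_on S q \<longleftrightarrow>
     (\<forall>x\<in>S. \<forall>y\<in>S. 0 \<le> q x y) \<and>
     (\<forall>x\<in>S. \<forall>y\<in>S. q x y = 0 \<and> q y x = 0 \<longleftrightarrow> x = y) \<and>
     (\<forall>x\<in>S. \<forall>y\<in>S. \<forall>z\<in>S. q x z \<le> q x y + q y z)"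

definition rev_dist :: "('a \<Rightarrow> 'a \<Rightarrow> real) \<Rightarrow> 'a \<Rightarrow> 'a \<Rightarrow> real" where
  "rev_dist d x y = d y x"

definition sym_dist :: "('a \<Rightarrow> 'a \<Rightarrow> real) \<Rightarrow> 'a \<Rightarrow> 'a \<Rightarrow> real" where
  "sym_dist d x y = (d x y + rev_dist d x y) / 2"

definition forward_Cauchy :: "'a set \<Rightarrow> ('a \<Rightarrow> 'a \<Rightarrow> real) \<Rightarrow> (nat \<Rightarrow> 'a) set" where
  "forward_Cauchy M d = {x. range x \<subseteq> M \<and>
     (\<forall>\<epsilon>>0. \<exists>n0. \<forall>n m. n0 \<le> n \<and> n \<le> m \<longrightarrow> d (x n) (x m) < \<epsilon>)}"

(* All inner limits and the outer limit exist in the extended reals, and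
   lim_n (lim_m (f n m)) = L. *)
definition iterated_limit :: "(nat \<Rightarrow> nat \<Rightarrow> real) \<Rightarrow> ereal \<Rightarrow> bool" where
  "iterated_limit f L \<longleftrightarrow>
     (\<exists>a. (\<forall>n. (\<lambda>m. ereal (f n m)) \<longlonglongrightarrow> a n) \<and> a \<longlonglongrightarrow> L)"

definition Cauchy_equiv ::
    "'a set \<Rightarrow> ('a \<Rightarrow> 'a \<Rightarrow> real) \<Rightarrow> ((nat \<Rightarrow> 'a) \<times> (nat \<Rightarrow> 'a)) set" where
  "Cauchy_equiv M d = {(x, x'). x \<in> forward_Cauchy M d \<and> x' \<in> forward_Cauchy M d \<and>
     iterated_limit (\<lambda>n m. d (x n) (x' m)) 0 \<and> iterated_limit (\<lambda>n m. d (x' n) (x m)) 0}"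

(* The backward Cauchy completion is forward_completion M (rev_dist d). *)
definition forward_completion :: "'a set \<Rightarrow> ('a \<Rightarrow> 'a \<Rightarrow> real) \<Rightarrow> (nat \<Rightarrow> 'a) set set" where
  "forward_completion M d = forward_Cauchy M d // Cauchy_equiv M d"

(* A point x of M, viewed in a completion, is the set of all sequences converging to x.
   By tendsto_iff the order of the arguments of d is irrelevant. *)
definition point_class :: "'a set \<Rightarrow> ('a \<Rightarrow> 'a \<Rightarrow> real) \<Rightarrow> 'a \<Rightarrow> (nat \<Rightarrow> 'a) set" where
  "point_class M d x = {s. range s \<subseteq> M \<and> (\<lambda>n. d x (s n)) \<longlonglongrightarrow> 0}"

definition forward_boundary :: "'a set \<Rightarrow> ('a \<Rightarrow> 'a \<Rightarrow> real) \<Rightarrow> (nat \<Rightarrow> 'a) set set" where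
  "forward_boundary M d = forward_completion M d - point_class M d ` M"

(* Boundary points are sets of sequences, so the intersection consists of the sets that are
   an equivalence class both for d and for rev_dist d. *)
definition sym_boundary :: "'a set \<Rightarrow> ('a \<Rightarrow> 'a \<Rightarrow> real) \<Rightarrow> (nat \<Rightarrow> 'a) set set" where
  "sym_boundary M d = forward_boundary M d \<inter> forward_boundary M (rev_dist d)"

definition sym_completion :: "'a set \<Rightarrow> ('a \<Rightarrow> 'a \<Rightarrow> real) \<Rightarrow> (nat \<Rightarrow> 'a) set set" where
  "sym_completion M d = point_class M d ` M \<union> sym_boundary M d"

(* Meaningful only if the iterated limit exists and does not depend on the representatives. *)
definition d_Q :: "('a \<Rightarrow> 'a \<Rightarrow> real) \<Rightarrow> (nat \<Rightarrow> 'a) set \<Rightarrow> (nat \<Rightarrow> 'a) set \<Rightarrow> ereal" where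
  "d_Q d P R = (THE L. \<exists>x\<in>P. \<exists>y\<in>R. iterated_limit (\<lambda>n m. d (x n) (y m)) L)"

(* q is given on S by the iterated limit of e, for every choice of representatives. *)
definition iterated_limit_on ::
    "(nat \<Rightarrow> 'a) set set \<Rightarrow> ('a \<Rightarrow> 'a \<Rightarrow> real) \<Rightarrow>
     ((nat \<Rightarrow> 'a) set \<Rightarrow> (nat \<Rightarrow> 'a) set \<Rightarrow> ereal) \<Rightarrow> bool" where
  "iterated_limit_on S e q \<longleftrightarrow>
     (\<forall>P\<in>S. \<forall>R\<in>S. \<forall>x\<in>P. \<forall>y\<in>R. iterated_limit (\<lambda>n m. e (x n) (y m)) (q P R))"

(* q, defined on S, restricts to e on M, where j identifies M with a subset of S. *)
definition extends_along ::
    "('a \<Rightarrow> 'b) \<Rightarrow> 'a set \<Rightarrow> 'b set \<Rightarrow> ('a \<Rightarrow> 'a \<Rightarrow> real) \<Rightarrow> ('b \<Rightarrow> 'b \<Rightarrow> ereal) \<Rightarrow> bool" where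
  "extends_along j M S e q \<longleftrightarrow>
     inj_on j M \<and> j ` M \<subseteq> S \<and> (\<forall>x\<in>M. \<forall>y\<in>M. q (j x) (j y) = ereal (e x y))"

end

theory Submission
  imports Defs
begin

text \<open>For forward Cauchy sequences $x$, $y$, the triangle inequality makes $m \mapsto d(x_n, y_m)$
  decreasing up to arbitrarily small errors, and $n \mapsto \lim_m d(x_n, y_m)$ increasing up to
  such errors; hence both limits exist, the inner one finite and the outer one possibly infinite.
  The triangle inequality passes to the iterated limits and gives transitivity of the equivalence,
  independence of the representatives and the quasi-distance axioms.\<close>

text \<open>The order of the two limits is the real obstacle. For \<open>x\<close> in
  \<open>P\<close> and \<open>y\<close> in \<open>R\<close>, \<open>d_Q d P R\<close> and
  \<open>d_Q (rev_dist d) R P\<close> are built from the same numbers, but the latter has the index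
  of \<open>x\<close> innermost. Being forward Cauchy does not allow the exchange: on the natural
  numbers with distance 1/2^n - 1/2^m from n to m if n \<le> m, and 1 otherwise, the sequence 0, 1,
  2, ... is forward Cauchy; its iterated limit against itself is 0, and 1 in the opposite order. The
  symmetrized distance therefore relies on representatives that are Cauchy for both \<open>d\<close>
  and \<open>rev_dist d\<close>.\<close>

section \<open>Convergence of almost monotone sequences in the extended reals\<close>

lemma ereal_convergent_if_limsup_le:
  fixes b :: "nat \<Rightarrow> ereal"
  assumes "\<And>e::real. e > 0 \<Longrightarrow> limsup b \<le> liminf b + ereal e"
  shows "\<exists>L. b \<longlonglongrightarrow> L"
proof -
  have "limsup b \<le> liminf b"
    using assms by (rule ereal_le_epsilon2)
  then have "limsup b = liminf b"
    by (intro antisym Liminf_le_Limsup) auto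
  then show ?thesis
    by (metis lim_imp_Liminf tendsto_iff_Liminf_eq_Limsup trivial_limit_sequentially)
qed

text \<open>Freezing \<open>n\<close> and taking the limsup over \<open>m\<close> gives
  \<open>limsup b \<le> b n + e\<close> for every late \<open>n\<close>; the liminf over
  \<open>n\<close> concludes. In the increasing case below, the liminf over \<open>m\<close> comes
  before the limsup over \<open>n\<close>.\<close>

lemma ereal_convergent_almost_decreasing:
  fixes b :: "nat \<Rightarrow> ereal"
  assumes "\<And>e::real. e > 0 \<Longrightarrow> \<exists>N. \<forall>n m. N \<le> n \<and> n \<le> m \<longrightarrow> b m \<le> b n + ereal e"
  shows "\<exists>L. b \<longlonglongrightarrow> L"
proof (rule ereal_convergent_if_limsup_le)
  fix e :: real assume "e > 0"
  then obtain N where N: "\<And>n m. N \<le> n \<Longrightarrow> n \<le> m \<Longrightarrow> b m \<le> b n + ereal e"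
    using assms by blast
  have "limsup b - ereal e \<le> b n" if "n \<ge> N" for n
  proof -
    have "limsup b \<le> b n + ereal e"
      using N[OF that] by (intro Limsup_bounded) (auto simp: eventually_sequentially)
    then show ?thesis
      by (simp add: ereal_minus_le)
  qed
  then have "limsup b - ereal e \<le> liminf b"
    by (intro Liminf_bounded) (auto simp: eventually_sequentially)
  then show "limsup b \<le> liminf b + ereal e"
    by (simp add: ereal_minus_le)
qed

lemma ereal_convergent_almost_increasing:
  fixes b :: "nat \<Rightarrow> ereal"
  assumes "\<And>e::real. e > 0 \<Longrightarrow> \<exists>N. \<forall>n m. N \<le> n \<and> n \<le> m \<longrightarrow> b n \<le> b m + ereal e"
  shows "\<exists>L. b \<longlonglongrightarrow> L"
proof (rule ereal_convergent_if_limsup_le)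
  fix e :: real assume "e > 0"
  then obtain N where N: "\<And>n m. N \<le> n \<Longrightarrow> n \<le> m \<Longrightarrow> b n \<le> b m + ereal e"
    using assms by blast
  have "b n \<le> liminf b + ereal e" if "n \<ge> N" for n
  proof -
    have "b n - ereal e \<le> liminf b"
      using N[OF that]
      by (intro Liminf_bounded) (auto simp: eventually_sequentially ereal_minus_le)
    then show ?thesis
      by (simp add: ereal_minus_le)
  qed
  then show "limsup b \<le> liminf b + ereal e"
    by (intro Limsup_bounded) (auto simp: eventually_sequentially)
qed

section \<open>Iterated limits of double sequences\<close>

lemma iterated_limit_unique:
  assumes "iterated_limit f L" "iterated_limit f L'"
  shows "L = L'"
proof -
  obtain a a' where a: "\<And>n. (\<lambda>m. ereal (f n m)) \<longlonglongrightarrow> a n" "a \<longlonglongrightarrow> L"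
    and a': "\<And>n. (\<lambda>m. ereal (f n m)) \<longlonglongrightarrow> a' n" "a' \<longlonglongrightarrow> L'"
    using assms unfolding iterated_limit_def by blast
  have "a = a'"
    using a(1) a'(1) by (blast intro: LIMSEQ_unique)
  then show ?thesis
    using a(2) a'(2) LIMSEQ_unique by blast
qed

lemma iterated_limit_nonneg:
  assumes "iterated_limit f L" "\<And>n m. 0 \<le> f n m"
  shows "0 \<le> L"
proof -
  obtain a where a: "\<And>n. (\<lambda>m. ereal (f n m)) \<longlonglongrightarrow> a n" "a \<longlonglongrightarrow> L"
    using assms(1) unfolding iterated_limit_def by blast
  have "0 \<le> a n" for n
    using assms(2) by (intro LIMSEQ_le_const[OF a(1)]) auto
  then show ?thesis
    by (intro LIMSEQ_le_const[OF a(2)]) auto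
qed

lemma iterated_limit_const [simp]: "iterated_limit (\<lambda>n m. c) (ereal c)"
  unfolding iterated_limit_def by (intro exI[of _ "\<lambda>_. ereal c"]) auto

text \<open>A double sequence that ignores one index has a single limit. This lemma and the next
  turn equivalence with a constant sequence into convergence to a point.\<close>

lemma iterated_limit_const_left_iff:
  "iterated_limit (\<lambda>n. f) L \<longleftrightarrow> (\<lambda>m. ereal (f m)) \<longlonglongrightarrow> L"
proof
  assume "iterated_limit (\<lambda>n. f) L"
  then obtain a where a: "\<And>n. (\<lambda>m. ereal (f m)) \<longlonglongrightarrow> a n" "a \<longlonglongrightarrow> L"
    unfolding iterated_limit_def by blast
  then have "a = (\<lambda>_. a 0)"
    by (blast intro: LIMSEQ_unique)
  with a(2) have "a 0 = L"
    by (metis LIMSEQ_const_iff)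
  with a(1) show "(\<lambda>m. ereal (f m)) \<longlonglongrightarrow> L"
    by blast
next
  assume "(\<lambda>m. ereal (f m)) \<longlonglongrightarrow> L"
  then show "iterated_limit (\<lambda>n. f) L"
    unfolding iterated_limit_def by (intro exI[of _ "\<lambda>_. L"]) auto
qed

lemma iterated_limit_const_right_iff:
  "iterated_limit (\<lambda>n m. f n) L \<longleftrightarrow> (\<lambda>n. ereal (f n)) \<longlonglongrightarrow> L"
proof
  assume "iterated_limit (\<lambda>n m. f n) L"
  then obtain a where "\<And>n. ereal (f n) = a n" "a \<longlonglongrightarrow> L"
    unfolding iterated_limit_def by (auto simp: LIMSEQ_const_iff)
  then show "(\<lambda>n. ereal (f n)) \<longlonglongrightarrow> L"
    by simp
next
  assume "(\<lambda>n. ereal (f n)) \<longlonglongrightarrow> L"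
  then show "iterated_limit (\<lambda>n m. f n) L"
    unfolding iterated_limit_def by (intro exI[of _ "\<lambda>n. ereal (f n)"]) auto
qed

text \<open>All \<open>f n m\<close> with both indices large lie within \<open>e / 2\<close> of
  \<open>L\<close>, and sending \<open>m\<close> to infinity keeps this for \<open>a n\<close>, with
  \<le>. A joint limit says nothing about small \<open>n\<close>, so the inner limits are demanded
  separately by \<open>conv\<close>.\<close>

lemma iterated_limit_if_joint_limit:
  assumes conv: "\<And>n. convergent (f n)"
    and lim: "((\<lambda>(n, m). f n m) \<longlongrightarrow> L) (sequentially \<times>\<^sub>F sequentially)"
  shows "iterated_limit f (ereal L)"
proof -
  obtain a where a: "\<And>n. f n \<longlonglongrightarrow> a n"
    using conv unfolding convergent_def by metis
  have "a \<longlonglongrightarrow> L"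
  proof (rule LIMSEQ_I)
    fix e :: real assume "e > 0"
    then have "\<forall>\<^sub>F p in sequentially \<times>\<^sub>F sequentially. dist (case p of (n, m) \<Rightarrow> f n m) L < e / 2"
      using lim by (intro tendstoD) auto
    then obtain N where N: "\<And>n m. n \<ge> N \<Longrightarrow> m \<ge> N \<Longrightarrow> \<bar>f n m - L\<bar> < e / 2"
      unfolding eventually_prod_sequentially by (auto simp: dist_real_def)
    have "\<bar>a n - L\<bar> \<le> e / 2" if "n \<ge> N" for n
    proof (rule LIMSEQ_le_const2)
      show "(\<lambda>m. \<bar>f n m - L\<bar>) \<longlonglongrightarrow> \<bar>a n - L\<bar>"
        by (intro tendsto_intros a)
      show "\<exists>K. \<forall>m\<ge>K. \<bar>f n m - L\<bar> \<le> e / 2"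
        using N[OF that] by (meson less_imp_le)
    qed
    then show "\<exists>no. \<forall>n\<ge>no. norm (a n - L) < e"
      using \<open>e > 0\<close> by (intro exI[of _ N]) fastforce
  qed
  then show ?thesis
    unfolding iterated_limit_def using a by (intro exI[of _ "\<lambda>n. ereal (a n)"]) auto
qed

lemma forward_Cauchy_in: "x \<in> forward_Cauchy M d \<Longrightarrow> x n \<in> M"
  by (auto simp: forward_Cauchy_def)

lemma forward_CauchyD:
  assumes "x \<in> forward_Cauchy M d" "e > 0"
  obtains N where "\<And>n m. N \<le> n \<Longrightarrow> n \<le> m \<Longrightarrow> d (x n) (x m) < e"
proof -
  have "\<exists>N. \<forall>n m. N \<le> n \<and> n \<le> m \<longrightarrow> d (x n) (x m) < e"
    using assms by (simp add: forward_Cauchy_def)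
  then show ?thesis
    using that by auto
qed

section \<open>Existence of iterated limits and their triangle inequality\<close>

context generalized_metric_space
begin

text \<open>The axioms are invariant under exchanging the arguments of \<open>d\<close>.
  Interpreting the locale at \<open>rev_dist d\<close> thus yields every backward result from its
  forward counterpart.\<close>

lemma generalized_metric_space_rev_dist: "generalized_metric_space M (rev_dist d)"
proof
  show "rev_dist d x z \<le> rev_dist d x y + rev_dist d y z" if "x \<in> M" "y \<in> M" "z \<in> M" for x y z
    using triangle[of z y x] that by (simp add: rev_dist_def)
  show "rev_dist d x y = 0 \<and> rev_dist d y x = 0 \<longleftrightarrow> x = y" if "x \<in> M" "y \<in> M" for x y
    using zero[OF that] by (auto simp: rev_dist_def)
  show "(\<lambda>n. rev_dist d (s n) x) \<longlonglongrightarrow> 0 \<longleftrightarrow> (\<lambda>n. rev_dist d x (s n)) \<longlonglongrightarrow> 0"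
    if "range s \<subseteq> M" "x \<in> M" for s x
    using tendsto_iff[OF that] by (simp add: rev_dist_def)
qed (simp add: rev_dist_def nonneg)

lemma dist_self [simp]: "x \<in> M \<Longrightarrow> d x x = 0"
  using zero by blast

lemma convergent_to_forward_Cauchy:
  assumes "u \<in> M" "y \<in> forward_Cauchy M d"
  shows "convergent (\<lambda>m. d u (y m))"
proof -
  have M: "y n \<in> M" for n
    using assms(2) by (rule forward_Cauchy_in)
  have bound: "d u (y m) \<le> d u (y n) + d (y n) (y m)" for n m
    using triangle assms(1) M by blast
  have "\<exists>L. (\<lambda>m. ereal (d u (y m))) \<longlonglongrightarrow> L"
  proof (rule ereal_convergent_almost_decreasing)
    fix e :: real assume "e > 0"
    then obtain N where N: "\<And>n m. N \<le> n \<Longrightarrow> n \<le> m \<Longrightarrow> d (y n) (y m) < e"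
      using forward_CauchyD[OF assms(2)] by blast
    have "d u (y m) \<le> d u (y n) + e" if "N \<le> n" "n \<le> m" for n m
      using bound[of m n] N[OF that] by linarith
    then show "\<exists>N. \<forall>n m. N \<le> n \<and> n \<le> m \<longrightarrow> ereal (d u (y m)) \<le> ereal (d u (y n)) + ereal e"
      by auto
  qed
  then obtain L where L: "(\<lambda>m. ereal (d u (y m))) \<longlonglongrightarrow> L"
    by blast
  \<comment> \<open>Tolerance 1 is an arbitrary choice: the tail of \<open>y\<close> stays within a
    fixed distance of \<open>y N\<close>, which excludes an infinite \<open>L\<close>.\<close>
  obtain N where N: "\<And>n m. N \<le> n \<Longrightarrow> n \<le> m \<Longrightarrow> d (y n) (y m) < 1"
    using forward_CauchyD[OF assms(2), of 1] by auto
  have "0 \<le> L"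
    using nonneg[OF assms(1) M] by (intro LIMSEQ_le_const[OF L]) auto
  moreover have "L \<le> ereal (d u (y N) + 1)"
  proof (rule LIMSEQ_le_const2[OF L], intro exI allI impI)
    fix m assume "N \<le> m"
    then show "ereal (d u (y m)) \<le> ereal (d u (y N) + 1)"
      using bound[of m N] N[of N m] by simp
  qed
  ultimately obtain r where "L = ereal r"
    by (cases L) auto
  with L show ?thesis
    unfolding convergent_def by auto
qed

lemma iterated_limit_exists:
  assumes "x \<in> forward_Cauchy M d" "y \<in> forward_Cauchy M d"
  shows "\<exists>L. iterated_limit (\<lambda>n m. d (x n) (y m)) L"
proof -
  note xM = forward_Cauchy_in[OF assms(1)] and yM = forward_Cauchy_in[OF assms(2)]
  obtain a where a: "\<And>n. (\<lambda>m. d (x n) (y m)) \<longlonglongrightarrow> a n"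
    using convergent_to_forward_Cauchy[OF xM assms(2)] unfolding convergent_def by metis
  \<comment> \<open>The triangle inequality through \<open>x k\<close>, with \<open>m\<close> sent
    to infinity. As \<open>d (x n) (x k)\<close> is small for late \<open>n \<le> k\<close>, it
    makes \<open>a\<close> almost increasing.\<close>
  have bound: "a n \<le> d (x n) (x k) + a k" for n k
    using triangle[OF xM xM yM]
    by (intro LIMSEQ_le[OF a tendsto_add[OF tendsto_const a]]) auto
  have "\<exists>L. (\<lambda>n. ereal (a n)) \<longlonglongrightarrow> L"
  proof (rule ereal_convergent_almost_increasing)
    fix e :: real assume "e > 0"
    then obtain N where N: "\<And>n m. N \<le> n \<Longrightarrow> n \<le> m \<Longrightarrow> d (x n) (x m) < e"
      using forward_CauchyD[OF assms(1)] by blast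
    have "a n \<le> a k + e" if "N \<le> n" "n \<le> k" for n k
      using bound[of n k] N[OF that] by linarith
    then show "\<exists>N. \<forall>n m. N \<le> n \<and> n \<le> m \<longrightarrow> ereal (a n) \<le> ereal (a m) + ereal e"
      by auto
  qed
  then obtain L where "(\<lambda>n. ereal (a n)) \<longlonglongrightarrow> L"
    by blast
  then show ?thesis
    unfolding iterated_limit_def using a
    by (intro exI[of _ L] exI[of _ "\<lambda>n. ereal (a n)"]) auto
qed

text \<open>Start from \<open>d (x n) (z m) \<le> d (x n) (y k) + d (y k) (z m)\<close> and send
  \<open>m\<close>, \<open>k\<close>, \<open>n\<close> to infinity in this order: \<open>k\<close>
  is the inner index for \<open>A\<close> and the outer index for \<open>B\<close>, so each limit is
  one that is given. Nonnegativity makes addition continuous even at infinity.\<close>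

lemma iterated_limit_triangle:
  assumes "range x \<subseteq> M" "range y \<subseteq> M" "range z \<subseteq> M"
    and xy: "iterated_limit (\<lambda>n m. d (x n) (y m)) A"
    and yz: "iterated_limit (\<lambda>n m. d (y n) (z m)) B"
    and xz: "iterated_limit (\<lambda>n m. d (x n) (z m)) C"
  shows "C \<le> A + B"
proof -
  have xM: "x n \<in> M" and yM: "y n \<in> M" and zM: "z n \<in> M" for n
    using assms(1-3) by auto
  obtain a where a: "\<And>n. (\<lambda>m. ereal (d (x n) (y m))) \<longlonglongrightarrow> a n" "a \<longlonglongrightarrow> A"
    using xy unfolding iterated_limit_def by blast
  obtain b where b: "\<And>n. (\<lambda>m. ereal (d (y n) (z m))) \<longlonglongrightarrow> b n" "b \<longlonglongrightarrow> B"
    using yz unfolding iterated_limit_def by blast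
  obtain c where c: "\<And>n. (\<lambda>m. ereal (d (x n) (z m))) \<longlonglongrightarrow> c n" "c \<longlonglongrightarrow> C"
    using xz unfolding iterated_limit_def by blast
  have a0: "0 \<le> a n" and b0: "0 \<le> b n" for n
    using nonneg[OF xM yM] nonneg[OF yM zM]
    by (auto intro!: LIMSEQ_le_const[OF a(1)] LIMSEQ_le_const[OF b(1)])
  have A0: "0 \<le> A" and B0: "0 \<le> B"
    using a0 b0 by (auto intro!: LIMSEQ_le_const[OF a(2)] LIMSEQ_le_const[OF b(2)])
  have "c n \<le> ereal (d (x n) (y k)) + b k" for n k
  proof (rule LIMSEQ_le[OF c(1)])
    show "(\<lambda>m. ereal (d (x n) (y k)) + ereal (d (y k) (z m))) \<longlonglongrightarrow> ereal (d (x n) (y k)) + b k"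
      using b0[of k] by (intro tendsto_add_ereal_nonneg tendsto_const b(1)) auto
  qed (use triangle[OF xM yM zM] in auto)
  then have "c n \<le> a n + B" for n
    using a0[of n] B0
    by (intro LIMSEQ_le[OF tendsto_const tendsto_add_ereal_nonneg[OF _ _ a(1) b(2)]]) auto
  then show ?thesis
    using A0 B0
    by (intro LIMSEQ_le[OF c(2) tendsto_add_ereal_nonneg[OF _ _ a(2) tendsto_const]]) auto
qed

text \<open>The inner limit depends only on the \<open>m \<ge> n\<close>, and these are the pairs
  that the forward Cauchy condition controls.\<close>

lemma iterated_limit_self:
  assumes "x \<in> forward_Cauchy M d"
  shows "iterated_limit (\<lambda>n m. d (x n) (x m)) 0"
proof -
  note M = forward_Cauchy_in[OF assms]
  obtain a where a: "\<And>n. (\<lambda>m. d (x n) (x m)) \<longlonglongrightarrow> a n"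
    using convergent_to_forward_Cauchy[OF M assms] unfolding convergent_def by metis
  have "a \<longlonglongrightarrow> 0"
  proof (rule LIMSEQ_I)
    fix e :: real assume "e > 0"
    then obtain N where N: "\<And>n m. N \<le> n \<Longrightarrow> n \<le> m \<Longrightarrow> d (x n) (x m) < e / 2"
      using forward_CauchyD[OF assms, of "e / 2"] by auto
    have "norm (a n - 0) < e" if "N \<le> n" for n
    proof -
      have "0 \<le> a n"
        using nonneg[OF M M] by (intro LIMSEQ_le_const[OF a]) auto
      moreover have "a n \<le> e / 2"
        using N[OF that] by (intro LIMSEQ_le_const2[OF a]) (auto intro!: exI[of _ n] less_imp_le)
      ultimately show ?thesis
        using \<open>e > 0\<close> by simp
    qed
    then show "\<exists>no. \<forall>n\<ge>no. norm (a n - 0) < e"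
      by blast
  qed
  then show ?thesis
    unfolding iterated_limit_def using a
    by (intro exI[of _ "\<lambda>n. ereal (a n)"]) (auto simp: zero_ereal_def)
qed

lemma iterated_limit_nonneg_dist:
  assumes "x \<in> forward_Cauchy M d" "y \<in> forward_Cauchy M d"
    and "iterated_limit (\<lambda>n m. d (x n) (y m)) L"
  shows "0 \<le> L"
  using assms(3) nonneg[OF forward_Cauchy_in[OF assms(1)] forward_Cauchy_in[OF assms(2)]]
  by (rule iterated_limit_nonneg)

lemma iterated_limit_triangle_forward_Cauchy:
  assumes "x \<in> forward_Cauchy M d" "y \<in> forward_Cauchy M d" "z \<in> forward_Cauchy M d"
    and "iterated_limit (\<lambda>n m. d (x n) (y m)) A"
    and "iterated_limit (\<lambda>n m. d (y n) (z m)) B"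
    and "iterated_limit (\<lambda>n m. d (x n) (z m)) C"
  shows "C \<le> A + B"
  using assms(1-3) by (intro iterated_limit_triangle[OF _ _ _ assms(4-6)])
    (auto simp: forward_Cauchy_def)

section \<open>The quasi-distance on the equivalence classes\<close>

lemma equiv_Cauchy_equiv: "equiv (forward_Cauchy M d) (Cauchy_equiv M d)"
proof (rule equivI)
  show "Cauchy_equiv M d \<subseteq> forward_Cauchy M d \<times> forward_Cauchy M d"
    by (auto simp: Cauchy_equiv_def)
  show "refl_on (forward_Cauchy M d) (Cauchy_equiv M d)"
    by (auto simp: refl_on_def Cauchy_equiv_def iterated_limit_self)
  show "sym (Cauchy_equiv M d)"
    by (auto simp: sym_def Cauchy_equiv_def)
  have lim0: "iterated_limit (\<lambda>n m. d (x n) (z m)) 0"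
    if xyz: "x \<in> forward_Cauchy M d" "y \<in> forward_Cauchy M d" "z \<in> forward_Cauchy M d"
      "iterated_limit (\<lambda>n m. d (x n) (y m)) 0" "iterated_limit (\<lambda>n m. d (y n) (z m)) 0"
    for x y z
  proof -
    obtain L where L: "iterated_limit (\<lambda>n m. d (x n) (z m)) L"
      using iterated_limit_exists xyz(1,3) by blast
    \<comment> \<open>A limit is known to exist; the triangle inequality through \<open>y\<close>
      and nonnegativity squeeze it to 0.\<close>
    have "L \<le> 0" "0 \<le> L"
      using iterated_limit_triangle_forward_Cauchy[OF xyz L]
        iterated_limit_nonneg_dist[OF xyz(1,3) L] by auto
    with L show ?thesis
      by (simp add: antisym)
  qed
  show "trans (Cauchy_equiv M d)"
    unfolding trans_def Cauchy_equiv_def by (auto intro: lim0)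
qed

lemma forward_completion_class:
  assumes "P \<in> forward_completion M d"
  obtains x where "x \<in> P"
proof -
  obtain x where "x \<in> forward_Cauchy M d" "P = Cauchy_equiv M d `` {x}"
    using assms unfolding forward_completion_def by (rule quotientE)
  then show ?thesis
    using that equiv_class_self[OF equiv_Cauchy_equiv] by blast
qed

lemma forward_completion_forward_Cauchy:
  "P \<in> forward_completion M d \<Longrightarrow> x \<in> P \<Longrightarrow> x \<in> forward_Cauchy M d"
  using in_quotient_imp_subset[OF equiv_Cauchy_equiv] unfolding forward_completion_def by blast

lemma forward_completion_eqI:
  assumes "P \<in> forward_completion M d" "R \<in> forward_completion M d" "x \<in> P" "y \<in> R"
    "(x, y) \<in> Cauchy_equiv M d"
  shows "P = R"
  using quotient_eqI[OF equiv_Cauchy_equiv] assms unfolding forward_completion_def by blast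

lemma forward_completion_equiv:
  assumes "P \<in> forward_completion M d" "x \<in> P" "y \<in> P"
  shows "(x, y) \<in> Cauchy_equiv M d"
  using in_quotient_imp_in_rel[OF equiv_Cauchy_equiv] assms unfolding forward_completion_def
  by blast

text \<open>Representatives are replaced one at a time, through the mixed limit \<open>K\<close>,
  and each replacement costs 0. Exchanging the roles of the two pairs gives the reverse
  inequality.\<close>

lemma iterated_limit_le_representatives:
  assumes "(x', x) \<in> Cauchy_equiv M d" "(y, y') \<in> Cauchy_equiv M d"
    and L: "iterated_limit (\<lambda>n m. d (x n) (y m)) L"
    and L': "iterated_limit (\<lambda>n m. d (x' n) (y' m)) L'"
  shows "L' \<le> L"
proof -
  have fC: "x \<in> forward_Cauchy M d" "x' \<in> forward_Cauchy M d" "y \<in> forward_Cauchy M d"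
      "y' \<in> forward_Cauchy M d"
    and x0: "iterated_limit (\<lambda>n m. d (x' n) (x m)) 0"
    and y0: "iterated_limit (\<lambda>n m. d (y n) (y' m)) 0"
    using assms(1,2) by (auto simp: Cauchy_equiv_def)
  obtain K where K: "iterated_limit (\<lambda>n m. d (x n) (y' m)) K"
    using iterated_limit_exists fC by blast
  have "K \<le> L + 0"
    by (rule iterated_limit_triangle_forward_Cauchy[OF fC(1,3,4) L y0 K])
  moreover have "L' \<le> 0 + K"
    by (rule iterated_limit_triangle_forward_Cauchy[OF fC(2,1,4) x0 K L'])
  ultimately show ?thesis
    by auto
qed

text \<open>This justifies the definite description in \<open>d_Q\<close>; from here on
  \<open>d_Q\<close> is handled only through this limit and uniqueness.\<close>

lemma iterated_limit_d_Q:
  assumes "P \<in> forward_completion M d" "R \<in> forward_completion M d" "x \<in> P" "y \<in> R"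
  shows "iterated_limit (\<lambda>n m. d (x n) (y m)) (d_Q d P R)"
proof -
  obtain L where L: "iterated_limit (\<lambda>n m. d (x n) (y m)) L"
    using iterated_limit_exists forward_completion_forward_Cauchy assms by blast
  have "d_Q d P R = L"
    unfolding d_Q_def
  proof (rule the_equality)
    show "\<exists>x\<in>P. \<exists>y\<in>R. iterated_limit (\<lambda>n m. d (x n) (y m)) L"
      using L assms(3,4) by blast
    fix L' assume "\<exists>x\<in>P. \<exists>y\<in>R. iterated_limit (\<lambda>n m. d (x n) (y m)) L'"
    then obtain x' y' where xy': "x' \<in> P" "y' \<in> R"
      and L': "iterated_limit (\<lambda>n m. d (x' n) (y' m)) L'"
      by blast
    note equivP = forward_completion_equiv[OF assms(1)]
      and equivR = forward_completion_equiv[OF assms(2)]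
    show "L' = L"
      using iterated_limit_le_representatives[OF equivP equivR L L']
        iterated_limit_le_representatives[OF equivP equivR L' L] xy' assms(3,4)
      by (simp add: antisym)
  qed
  with L show ?thesis
    by simp
qed

lemma d_Q_eqI:
  assumes "P \<in> forward_completion M d" "R \<in> forward_completion M d" "x \<in> P" "y \<in> R"
    "iterated_limit (\<lambda>n m. d (x n) (y m)) L"
  shows "d_Q d P R = L"
  using iterated_limit_unique[OF iterated_limit_d_Q[OF assms(1-4)] assms(5)] .

lemma iterated_limit_on_d_Q: "iterated_limit_on (forward_completion M d) d (d_Q d)"
  unfolding iterated_limit_on_def using iterated_limit_d_Q by blast

lemma quasi_distance_on_d_Q: "quasi_distance_on (forward_completion M d) (d_Q d)"
  unfolding quasi_distance_on_def
proof (intro conjI ballI)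
  fix P R assume PR: "P \<in> forward_completion M d" "R \<in> forward_completion M d"
  obtain x y where xy: "x \<in> P" "y \<in> R"
    using PR forward_completion_class by metis
  have fC: "x \<in> forward_Cauchy M d" "y \<in> forward_Cauchy M d"
    using forward_completion_forward_Cauchy PR xy by auto
  have lims: "iterated_limit (\<lambda>n m. d (x n) (y m)) (d_Q d P R)"
      "iterated_limit (\<lambda>n m. d (y n) (x m)) (d_Q d R P)"
    using PR xy by (auto intro: iterated_limit_d_Q)
  show "0 \<le> d_Q d P R"
    using iterated_limit_nonneg_dist[OF fC lims(1)] .
  show "d_Q d P R = 0 \<and> d_Q d R P = 0 \<longleftrightarrow> P = R"
  proof
    \<comment> \<open>For representatives, these two equations are exactly the relation by which the
      classes are formed.\<close>
    assume "d_Q d P R = 0 \<and> d_Q d R P = 0"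
    then have "(x, y) \<in> Cauchy_equiv M d"
      using fC lims by (auto simp: Cauchy_equiv_def)
    then show "P = R"
      using forward_completion_eqI PR xy by blast
  next
    assume "P = R"
    then show "d_Q d P R = 0 \<and> d_Q d R P = 0"
      using d_Q_eqI[OF PR(1) PR(1) xy(1) xy(1) iterated_limit_self[OF fC(1)]] by simp
  qed
next
  fix P R Q assume PRQ: "P \<in> forward_completion M d" "R \<in> forward_completion M d"
    "Q \<in> forward_completion M d"
  obtain x y z where xyz: "x \<in> P" "y \<in> R" "z \<in> Q"
    using PRQ forward_completion_class by metis
  show "d_Q d P Q \<le> d_Q d P R + d_Q d R Q"
    using PRQ xyz forward_completion_forward_Cauchy
    by (intro iterated_limit_triangle_forward_Cauchy[of x y z] iterated_limit_d_Q) auto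
qed

section \<open>The points of \<open>M\<close> inside the completion\<close>

lemma const_in_point_class: "x \<in> M \<Longrightarrow> (\<lambda>_. x) \<in> point_class M d x"
  by (auto simp: point_class_def)

text \<open>By \<open>tendsto_iff\<close>, a point of \<open>M\<close> is the same set of sequences
  in both completions, so \<open>sym_completion\<close> contains one copy of
  \<open>M\<close>.\<close>

lemma point_class_rev_dist: "x \<in> M \<Longrightarrow> point_class M (rev_dist d) x = point_class M d x"
  unfolding point_class_def rev_dist_def using tendsto_iff by blast

lemma point_class_forward_Cauchy:
  assumes "x \<in> M" "s \<in> point_class M d x"
  shows "s \<in> forward_Cauchy M d"
proof -
  have s: "range s \<subseteq> M" "(\<lambda>n. d x (s n)) \<longlonglongrightarrow> 0"
    using assms(2) by (auto simp: point_class_def)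
  \<comment> \<open>The detour from \<open>s n\<close> to \<open>s m\<close> through
    \<open>x\<close> uses convergence in both argument orders.\<close>
  then have s': "(\<lambda>n. d (s n) x) \<longlonglongrightarrow> 0"
    using tendsto_iff assms(1) by blast
  have "\<exists>N. \<forall>n m. N \<le> n \<and> n \<le> m \<longrightarrow> d (s n) (s m) < e" if e: "e > 0" for e
  proof -
    obtain N1 where N1: "\<And>n. n \<ge> N1 \<Longrightarrow> \<bar>d x (s n)\<bar> < e / 2"
      using LIMSEQ_D[OF s(2), of "e / 2"] e by auto
    obtain N2 where N2: "\<And>n. n \<ge> N2 \<Longrightarrow> \<bar>d (s n) x\<bar> < e / 2"
      using LIMSEQ_D[OF s', of "e / 2"] e by auto
    have "d (s n) (s m) < e" if "max N1 N2 \<le> n" "n \<le> m" for n m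
      using N1[of m] N2[of n] that triangle[of "s n" x "s m"] s(1) assms(1) by fastforce
    then show ?thesis
      by blast
  qed
  with s(1) show ?thesis
    by (simp add: forward_Cauchy_def)
qed

lemma point_class_in_forward_completion:
  assumes "x \<in> M"
  shows "point_class M d x \<in> forward_completion M d"
proof -
  have const: "(\<lambda>_. x) \<in> forward_Cauchy M d"
    using point_class_forward_Cauchy const_in_point_class assms by blast
  \<comment> \<open>Against the constant sequence, the two conditions of the equivalence become
    \<open>d x (s n)\<close> and \<open>d (s n) x\<close> tending to 0.\<close>
  have "point_class M d x = Cauchy_equiv M d `` {\<lambda>_. x}"
  proof (intro set_eqI iffI)
    fix s assume s: "s \<in> point_class M d x"
    then have "range s \<subseteq> M" "(\<lambda>n. d x (s n)) \<longlonglongrightarrow> 0"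
      by (auto simp: point_class_def)
    moreover from this have "(\<lambda>n. d (s n) x) \<longlonglongrightarrow> 0"
      using tendsto_iff assms by blast
    ultimately show "s \<in> Cauchy_equiv M d `` {\<lambda>_. x}"
      using const point_class_forward_Cauchy[OF assms s]
      by (simp add: Cauchy_equiv_def iterated_limit_const_left_iff iterated_limit_const_right_iff
          zero_ereal_def)
  next
    fix s assume "s \<in> Cauchy_equiv M d `` {\<lambda>_. x}"
    then show "s \<in> point_class M d x"
      by (auto simp: Cauchy_equiv_def iterated_limit_const_left_iff zero_ereal_def
          point_class_def forward_Cauchy_def)
  qed
  with const show ?thesis
    unfolding forward_completion_def by (auto intro: quotientI)
qed

lemma d_Q_point_class:
  assumes "x \<in> M" "y \<in> M"
  shows "d_Q d (point_class M d x) (point_class M d y) = ereal (d x y)"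
  using assms
  by (intro d_Q_eqI[where x = "\<lambda>_. x" and y = "\<lambda>_. y"] point_class_in_forward_completion
      const_in_point_class iterated_limit_const)

lemma inj_on_point_class: "inj_on (point_class M d) M"
proof (rule inj_onI)
  fix x y assume "x \<in> M" "y \<in> M" "point_class M d x = point_class M d y"
  \<comment> \<open>\<open>d_Q\<close> recovers \<open>d\<close> from the classes, so points with
    equal classes have the same distances.\<close>
  then have "ereal (d x y) = ereal (d x x)" "ereal (d y x) = ereal (d x x)"
    using d_Q_point_class by metis+
  then show "x = y"
    using zero[OF \<open>x \<in> M\<close> \<open>y \<in> M\<close>] \<open>x \<in> M\<close> by simp
qed

lemma extends_along_d_Q:
  "extends_along (point_class M d) M (forward_completion M d) d (d_Q d)"
  unfolding extends_along_def
  using inj_on_point_class point_class_in_forward_completion d_Q_point_class by blast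

section \<open>Finiteness and symmetry on the symmetrized completion\<close>

lemma sym_completion_subset:
  "sym_completion M d \<subseteq> forward_completion M d \<inter> forward_completion M (rev_dist d)"
proof -
  interpret rev: generalized_metric_space M "rev_dist d"
    by (rule generalized_metric_space_rev_dist)
  have "point_class M d x \<in> forward_completion M (rev_dist d)" if "x \<in> M" for x
    using rev.point_class_in_forward_completion[OF that] point_class_rev_dist[OF that] by simp
  then show ?thesis
    using point_class_in_forward_completion
    by (auto simp: sym_completion_def sym_boundary_def forward_boundary_def)
qed

text \<open>For sequences that are Cauchy in both directions, the iterated limit is a joint limit, hence
  finite and insensitive to the order of the two limits; this makes the symmetrized limit symmetric.\<close>

lemma joint_limit_exists:
  assumes x: "x \<in> forward_Cauchy M d" "x \<in> forward_Cauchy M (rev_dist d)"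
    and y: "y \<in> forward_Cauchy M d" "y \<in> forward_Cauchy M (rev_dist d)"
  shows "\<exists>L. ((\<lambda>(n, m). d (x n) (y m)) \<longlongrightarrow> L) (sequentially \<times>\<^sub>F sequentially)"
proof -
  note xM = forward_Cauchy_in[OF x(1)] and yM = forward_Cauchy_in[OF y(1)]
  \<comment> \<open>The forward condition controls the pairs with \<open>n \<le> m\<close>, the
    backward one the others.\<close>
  have cauchy: "\<exists>N. \<forall>n\<ge>N. \<forall>m\<ge>N. d (s n) (s m) < e"
    if s: "s \<in> forward_Cauchy M d" "s \<in> forward_Cauchy M (rev_dist d)" "e > 0" for s e
  proof -
    obtain N1 where N1: "\<And>n m. N1 \<le> n \<Longrightarrow> n \<le> m \<Longrightarrow> d (s n) (s m) < e"
      using forward_CauchyD[OF s(1,3)] by blast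
    obtain N2 where N2: "\<And>n m. N2 \<le> n \<Longrightarrow> n \<le> m \<Longrightarrow> d (s m) (s n) < e"
      using forward_CauchyD[OF s(2,3)] unfolding rev_dist_def by blast
    have "d (s n) (s m) < e" if "max N1 N2 \<le> n" "max N1 N2 \<le> m" for n m
      using N1[of n m] N2[of m n] that by (cases "n \<le> m") auto
    then show ?thesis
      by blast
  qed
  have close: "\<exists>N. \<forall>n\<ge>N. \<forall>m\<ge>N. \<forall>n'\<ge>N. \<forall>m'\<ge>N. \<bar>d (x n) (y m) - d (x n') (y m')\<bar> < e"
    if e: "e > 0" for e
  proof -
    obtain N1 where N1: "\<And>n m. N1 \<le> n \<Longrightarrow> N1 \<le> m \<Longrightarrow> d (x n) (x m) < e / 2"
      using cauchy[OF x, of "e / 2"] e by auto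
    obtain N2 where N2: "\<And>n m. N2 \<le> n \<Longrightarrow> N2 \<le> m \<Longrightarrow> d (y n) (y m) < e / 2"
      using cauchy[OF y, of "e / 2"] e by auto
    \<comment> \<open>The path from \<open>x n\<close> to \<open>y m\<close> through
      \<open>x n'\<close> and \<open>y m'\<close> costs \<open>e / 2\<close> at each end.\<close>
    have less: "d (x n) (y m) < d (x n') (y m') + e"
      if "max N1 N2 \<le> n" "max N1 N2 \<le> m" "max N1 N2 \<le> n'" "max N1 N2 \<le> m'" for n m n' m'
      using triangle[OF xM[of n] xM[of n'] yM[of m]] triangle[OF xM[of n'] yM[of m'] yM[of m]]
        N1[of n n'] N2[of m' m] that by simp
    have "\<bar>d (x n) (y m) - d (x n') (y m')\<bar> < e"
      if "max N1 N2 \<le> n" "max N1 N2 \<le> m" "max N1 N2 \<le> n'" "max N1 N2 \<le> m'" for n m n' m'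
      using less[OF that] less[OF that(3,4,1,2)] by linarith
    then show ?thesis
      by blast
  qed
  \<comment> \<open>The diagonal supplies the candidate for the joint limit; \<open>close\<close>
    carries it to all large pairs of indices.\<close>
  have "Cauchy (\<lambda>n. d (x n) (y n))"
  proof (rule metric_CauchyI)
    fix e :: real assume "e > 0"
    then show "\<exists>N. \<forall>m\<ge>N. \<forall>n\<ge>N. dist (d (x m) (y m)) (d (x n) (y n)) < e"
      using close[of e] unfolding dist_real_def by blast
  qed
  then obtain L where L: "(\<lambda>n. d (x n) (y n)) \<longlonglongrightarrow> L"
    using Cauchy_convergent_iff convergent_def by blast
  have "((\<lambda>(n, m). d (x n) (y m)) \<longlongrightarrow> L) (sequentially \<times>\<^sub>F sequentially)"
  proof (rule tendstoI)
    fix e :: real assume e: "e > 0"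
    obtain N where N: "\<And>n m k. n \<ge> N \<Longrightarrow> m \<ge> N \<Longrightarrow> k \<ge> N \<Longrightarrow>
        \<bar>d (x n) (y m) - d (x k) (y k)\<bar> < e / 2"
      using close[of "e / 2"] e by (metis half_gt_zero)
    obtain K where K: "\<And>k. k \<ge> K \<Longrightarrow> \<bar>d (x k) (y k) - L\<bar> < e / 2"
      using LIMSEQ_D[OF L, of "e / 2"] e by auto
    have "\<bar>d (x n) (y m) - L\<bar> < e" if "n \<ge> N" "m \<ge> N" for n m
      using N[OF that, of "max N K"] K[of "max N K"] by (simp add: abs_if split: if_splits)
    then show "\<forall>\<^sub>F p in sequentially \<times>\<^sub>F sequentially. dist (case p of (n, m) \<Rightarrow> d (x n) (y m)) L < e"
      unfolding eventually_prod_sequentially by (auto simp: dist_real_def)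
  qed
  then show ?thesis ..
qed

text \<open>\<open>d_Q d P R\<close> and \<open>d_Q (rev_dist d) R P\<close> are the two iterated
  limits of one double sequence, so a joint limit identifies them. The real witnesses
  \<open>K\<close> and \<open>L\<close> turn later computations into real arithmetic.\<close>

lemma sym_completion_d_Q:
  assumes "P \<in> sym_completion M d" "R \<in> sym_completion M d"
  obtains K L where "K \<ge> 0" "L \<ge> 0"
    "d_Q d P R = ereal K" "d_Q (rev_dist d) R P = ereal K"
    "d_Q d R P = ereal L" "d_Q (rev_dist d) P R = ereal L"
    "\<And>x y. x \<in> P \<Longrightarrow> y \<in> R \<Longrightarrow>
      iterated_limit (\<lambda>n m. sym_dist d (x n) (y m)) (ereal ((K + L) / 2))"
proof -
  interpret rev: generalized_metric_space M "rev_dist d"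
    by (rule generalized_metric_space_rev_dist)
  have PR: "P \<in> forward_completion M d" "R \<in> forward_completion M d"
    "P \<in> forward_completion M (rev_dist d)" "R \<in> forward_completion M (rev_dist d)"
    using sym_completion_subset assms by auto
  have fC: "z \<in> forward_Cauchy M d" "z \<in> forward_Cauchy M (rev_dist d)" if "z \<in> P \<union> R" for z
    using that PR forward_completion_forward_Cauchy rev.forward_completion_forward_Cauchy by auto
  let ?F = "sequentially \<times>\<^sub>F sequentially :: (nat \<times> nat) filter"
  have swap: "((\<lambda>(n, m). f m n) \<longlongrightarrow> l) ?F" if "((\<lambda>(n, m). f n m) \<longlongrightarrow> l) ?F"
    for f :: "nat \<Rightarrow> nat \<Rightarrow> real" and l
  proof -
    have "filterlim (\<lambda>(n, m). (m, n)) ?F ?F"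
      unfolding case_prod_beta by (intro filterlim_Pair filterlim_fst filterlim_snd)
    from filterlim_compose[OF that this] show ?thesis
      by (simp add: case_prod_beta')
  qed
  have conv: "convergent (\<lambda>m. d (x n) (y m))" "convergent (\<lambda>m. d (y m) (x n))"
    if "x \<in> P \<union> R" "y \<in> P \<union> R" for x y n
    using convergent_to_forward_Cauchy[OF forward_Cauchy_in fC(1)]
      rev.convergent_to_forward_Cauchy[OF forward_Cauchy_in fC(2)] fC that
    unfolding rev_dist_def by blast+
  \<comment> \<open>The limit is named by \<open>d_Q d A B\<close> because it must be the same for
    all representatives \<open>x\<close> and \<open>y\<close>.\<close>
  have joint: "((\<lambda>(n, m). d (x n) (y m)) \<longlongrightarrow> real_of_ereal (d_Q d A B)) ?F \<and>
      d_Q d A B = ereal (real_of_ereal (d_Q d A B)) \<and>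
      d_Q (rev_dist d) B A = ereal (real_of_ereal (d_Q d A B))"
    if AB: "A \<in> {P, R}" "B \<in> {P, R}" and xy: "x \<in> A" "y \<in> B" for A B x y
  proof -
    have AB': "A \<in> forward_completion M d" "B \<in> forward_completion M d"
      "A \<in> forward_completion M (rev_dist d)" "B \<in> forward_completion M (rev_dist d)"
      using AB PR by auto
    have xy': "x \<in> P \<union> R" "y \<in> P \<union> R"
      using AB xy by auto
    obtain K where K: "((\<lambda>(n, m). d (x n) (y m)) \<longlongrightarrow> K) ?F"
      using joint_limit_exists[OF fC[OF xy'(1)] fC[OF xy'(2)]] by blast
    have "d_Q d A B = ereal K"
      using xy' by (intro d_Q_eqI[OF AB'(1,2) xy] iterated_limit_if_joint_limit conv K) auto
    moreover have "d_Q (rev_dist d) B A = ereal K"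
    proof (rule rev.d_Q_eqI[OF AB'(4,3) xy(2,1)])
      show "iterated_limit (\<lambda>n m. rev_dist d (y n) (x m)) (ereal K)"
        unfolding rev_dist_def using xy'
        by (intro iterated_limit_if_joint_limit conv swap[OF K]) auto
    qed
    ultimately show ?thesis
      using K by simp
  qed
  let ?K = "real_of_ereal (d_Q d P R)" and ?L = "real_of_ereal (d_Q d R P)"
  obtain u v where uv: "u \<in> P" "v \<in> R"
    using PR forward_completion_class by metis
  show ?thesis
  proof (rule that)
    show "0 \<le> ?K" "0 \<le> ?L"
      using quasi_distance_on_d_Q PR by (auto simp: quasi_distance_on_def intro: real_of_ereal_pos)
    show "d_Q d P R = ereal ?K" "d_Q (rev_dist d) R P = ereal ?K"
      "d_Q d R P = ereal ?L" "d_Q (rev_dist d) P R = ereal ?L"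
      using joint[of P R u v] joint[of R P v u] uv by auto
    fix x y assume xy: "x \<in> P" "y \<in> R"
    have "((\<lambda>(n, m). d (x n) (y m)) \<longlongrightarrow> ?K) ?F" "((\<lambda>(n, m). d (y m) (x n)) \<longlongrightarrow> ?L) ?F"
      using joint[of P R x y] joint[of R P y x] swap[of "\<lambda>m n. d (y m) (x n)"] xy by auto
    then have lim: "((\<lambda>(n, m). sym_dist d (x n) (y m)) \<longlongrightarrow> (?K + ?L) / 2) ?F"
      unfolding sym_dist_def rev_dist_def case_prod_beta by (intro tendsto_intros) auto
    have "convergent (\<lambda>m. sym_dist d (x n) (y m))" for n
      unfolding sym_dist_def rev_dist_def divide_inverse
      using conv[of x y n] xy by (intro convergent_mult convergent_add convergent_const) auto
    from iterated_limit_if_joint_limit[OF this lim]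
    show "iterated_limit (\<lambda>n m. sym_dist d (x n) (y m)) (ereal ((?K + ?L) / 2))" .
  qed
qed

text \<open>The value outside the carrier is irrelevant, but \<^locale>\<open>Metric_space\<close> requires
  nonnegativity and symmetry everywhere.\<close>

definition sym_d_Q :: "(nat \<Rightarrow> 'a) set \<Rightarrow> (nat \<Rightarrow> 'a) set \<Rightarrow> real" where
  "sym_d_Q P R = (if P \<in> sym_completion M d \<and> R \<in> sym_completion M d
     then real_of_ereal ((d_Q d P R + d_Q (rev_dist d) P R) / 2) else 0)"

lemma ereal_sym_d_Q:
  assumes "P \<in> sym_completion M d" "R \<in> sym_completion M d"
  shows "ereal (sym_d_Q P R) = (d_Q d P R + d_Q (rev_dist d) P R) / 2"
proof -
  obtain K L where "d_Q d P R = ereal K" "d_Q (rev_dist d) P R = ereal L"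
    by (rule sym_completion_d_Q[OF assms]) (rule that)
  then show ?thesis
    using assms by (simp add: sym_d_Q_def)
qed

text \<open>In this form symmetry is commutativity of addition, and the quasi-distance axioms of
  \<open>d_Q d\<close> alone suffice for the metric axioms.\<close>

lemma ereal_sym_d_Q_forward:
  assumes "P \<in> sym_completion M d" "R \<in> sym_completion M d"
  shows "ereal (sym_d_Q P R) = (d_Q d P R + d_Q d R P) / 2"
proof -
  have "d_Q (rev_dist d) P R = d_Q d R P"
    by (rule sym_completion_d_Q[OF assms]) simp
  then show ?thesis
    by (simp add: ereal_sym_d_Q[OF assms])
qed

lemma iterated_limit_on_sym_d_Q:
  "iterated_limit_on (sym_completion M d) (sym_dist d) (\<lambda>P R. ereal (sym_d_Q P R))"
  unfolding iterated_limit_on_def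
proof (intro ballI)
  fix P R x y assume PR: "P \<in> sym_completion M d" "R \<in> sym_completion M d" and xy: "x \<in> P" "y \<in> R"
  obtain K L where "d_Q d P R = ereal K" "d_Q (rev_dist d) P R = ereal L"
    and "iterated_limit (\<lambda>n m. sym_dist d (x n) (y m)) (ereal ((K + L) / 2))"
    by (rule sym_completion_d_Q[OF PR]) (rule that, use xy in auto)
  then show "iterated_limit (\<lambda>n m. sym_dist d (x n) (y m)) (ereal (sym_d_Q P R))"
    by (simp add: ereal_sym_d_Q[OF PR])
qed

lemma extends_along_sym_d_Q:
  "extends_along (point_class M d) M (sym_completion M d) (sym_dist d) (\<lambda>P R. ereal (sym_d_Q P R))"
proof -
  have "ereal (sym_d_Q (point_class M d x) (point_class M d y)) = ereal (sym_dist d x y)"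
    if "x \<in> M" "y \<in> M" for x y
    using that by (subst ereal_sym_d_Q_forward)
      (auto simp: sym_completion_def d_Q_point_class sym_dist_def rev_dist_def)
  then show ?thesis
    unfolding extends_along_def using inj_on_point_class by (auto simp: sym_completion_def)
qed

lemma Metric_space_sym_d_Q: "Metric_space (sym_completion M d) sym_d_Q"
proof
  fix P R
  show "0 \<le> sym_d_Q P R"
  proof (cases "P \<in> sym_completion M d \<and> R \<in> sym_completion M d")
    case True
    then have PR: "P \<in> sym_completion M d" "R \<in> sym_completion M d"
      by auto
    obtain K L where "K \<ge> 0" "L \<ge> 0" "d_Q d P R = ereal K" "d_Q d R P = ereal L"
      by (rule sym_completion_d_Q[OF PR]) (rule that)
    then show ?thesis
      using ereal_sym_d_Q_forward[OF PR] by simp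
  qed (auto simp: sym_d_Q_def)
  show "sym_d_Q P R = sym_d_Q R P"
  proof (cases "P \<in> sym_completion M d \<and> R \<in> sym_completion M d")
    case True
    then have "ereal (sym_d_Q P R) = ereal (sym_d_Q R P)"
      by (simp only: ereal_sym_d_Q_forward add.commute)
    then show ?thesis
      by simp
  qed (auto simp: sym_d_Q_def)
next
  fix P R assume PR: "P \<in> sym_completion M d" "R \<in> sym_completion M d"
  obtain K L where KL: "K \<ge> 0" "L \<ge> 0" "d_Q d P R = ereal K" "d_Q d R P = ereal L"
    by (rule sym_completion_d_Q[OF PR]) (rule that)
  have "sym_d_Q P R = (K + L) / 2"
    using ereal_sym_d_Q_forward[OF PR] KL by simp
  \<comment> \<open>For nonnegative \<open>K\<close> and \<open>L\<close>, the average vanishes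
    exactly when both do.\<close>
  moreover have "K = 0 \<and> L = 0 \<longleftrightarrow> P = R"
    using quasi_distance_on_d_Q sym_completion_subset PR KL
    unfolding quasi_distance_on_def by (metis ereal_eq_0(1) le_inf_iff subsetD)
  ultimately show "sym_d_Q P R = 0 \<longleftrightarrow> P = R"
    using KL by auto
next
  fix P R Q assume PRQ: "P \<in> sym_completion M d" "R \<in> sym_completion M d" "Q \<in> sym_completion M d"
  obtain K L where KL: "d_Q d P R = ereal K" "d_Q d R P = ereal L"
    by (rule sym_completion_d_Q[OF PRQ(1,2)]) (rule that)
  obtain K' L' where KL': "d_Q d R Q = ereal K'" "d_Q d Q R = ereal L'"
    by (rule sym_completion_d_Q[OF PRQ(2,3)]) (rule that)
  obtain K'' L'' where KL'': "d_Q d P Q = ereal K''" "d_Q d Q P = ereal L''"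
    by (rule sym_completion_d_Q[OF PRQ(1,3)]) (rule that)
  have "P \<in> forward_completion M d" "R \<in> forward_completion M d" "Q \<in> forward_completion M d"
    using PRQ sym_completion_subset by auto
  \<comment> \<open>The triangle inequality is taken in both directions through \<open>R\<close>;
    averaging the two gives the one for \<open>sym_d_Q\<close>.\<close>
  then have "d_Q d P Q \<le> d_Q d P R + d_Q d R Q" "d_Q d Q P \<le> d_Q d Q R + d_Q d R P"
    using quasi_distance_on_d_Q unfolding quasi_distance_on_def by blast+
  then have "K'' \<le> K + K'" "L'' \<le> L' + L"
    by (simp_all add: KL KL' KL'')
  then show "sym_d_Q P Q \<le> sym_d_Q P R + sym_d_Q R Q"
    using ereal_sym_d_Q_forward[OF PRQ(1,2)] ereal_sym_d_Q_forward[OF PRQ(2,3)]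
      ereal_sym_d_Q_forward[OF PRQ(1,3)] by (simp add: KL KL' KL'')
qed

end

theorem proposition3p25:
  fixes M :: "'a set" and d :: "'a \<Rightarrow> 'a \<Rightarrow> real"
  assumes "generalized_metric_space M d"
  shows
    "(iterated_limit_on (forward_completion M d) d (d_Q d) \<and>
      quasi_distance_on (forward_completion M d) (d_Q d) \<and>
      extends_along (point_class M d) M (forward_completion M d) d (d_Q d)) \<and>
     (iterated_limit_on (forward_completion M (rev_dist d)) (rev_dist d) (d_Q (rev_dist d)) \<and>
      quasi_distance_on (forward_completion M (rev_dist d)) (d_Q (rev_dist d)) \<and>
      extends_along (point_class M (rev_dist d)) M (forward_completion M (rev_dist d))
        (rev_dist d) (d_Q (rev_dist d))) \<and>
     sym_completion M d \<subseteq> forward_completion M d \<inter> forward_completion M (rev_dist d) \<and>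
     (\<exists>ds. Metric_space (sym_completion M d) ds \<and>
        iterated_limit_on (sym_completion M d) (sym_dist d) (\<lambda>P R. ereal (ds P R)) \<and>
        extends_along (point_class M d) M (sym_completion M d) (sym_dist d)
          (\<lambda>P R. ereal (ds P R)) \<and>
        (\<forall>P\<in>sym_completion M d. \<forall>R\<in>sym_completion M d.
           ereal (ds P R) = (d_Q d P R + d_Q (rev_dist d) P R) / 2))"
proof -
  interpret generalized_metric_space M d
    by (rule assms)
  interpret rev: generalized_metric_space M "rev_dist d"
    by (rule generalized_metric_space_rev_dist)
  show ?thesis
    using iterated_limit_on_d_Q quasi_distance_on_d_Q extends_along_d_Q
      rev.iterated_limit_on_d_Q rev.quasi_distance_on_d_Q rev.extends_along_d_Q
      sym_completion_subset Metric_space_sym_d_Q iterated_limit_on_sym_d_Q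
      extends_along_sym_d_Q ereal_sym_d_Q
    by blast
qed

end
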